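(* Let $G$ be a graph, let $p$ be a positive integer, and let $\ell$ be a $2$-intersecting supermodular weakly subadditive integer-valued function on subsets of $V(G)$ such that for any two adjacent vertices $u$ and $v$, $\ell(u)+\ell(v)=\ell(\{u,v\})+1$. Then $G$ is $p\ell$-rigid if and only if $G$ can be decomposed into $p$ edge-disjoint spanning $\ell$-rigid subgraphs (i.e. $E(G)$ can be partitioned into the edge sets of $p$ spanning $\ell$-rigid subgraphs).
   Context: Graphs are finite, loopless, multiple edges allowed. $e_H(X)$ is the number of edges of $H$ with both ends in $X$. Set functions are zero on $\emptyset$, $\ell(v)=\ell(\{v\})$; $p\ell$ denotes the function $X\mapsto p\,\ell(X)$. $\ell$ is $2$-intersecting supermodular if $\ell(A\cap B)+\ell(A\cup B)\ge\ell(A)+\ell(B)$ whenever $|A\cap B|\ge 2$; weakly subadditive if $\sum_{v\in A}\ell(v)\ge\ell(A)$ for all $A$. For a set function $f$, a graph $H$ is $f$-rigid if it has a spanning subgraph $F$ with $e_F(X)\le\sum_{v\in X}f(v)-f(X)$ for all $X\subseteq V(H)$ and $|E(F)|=\sum_{v\in V(H)}f(v)-f(V(H))$. *)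

theory Defs
  imports Main "HOL-Library.Disjoint_Sets"
begin

text \<open>
  Undirected multigraphs: edges are abstract objects, so parallel edges are distinct edges with
  the same set of ends. Looplessness is the requirement that every edge has exactly two ends.
\<close>

record ('v, 'e) multigraph =
  verts :: "'v set"
  edges :: "'e set"
  ends :: "'e \<Rightarrow> 'v set"

definition finite_loopless_multigraph :: "('v, 'e) multigraph \<Rightarrow> bool" where
  "finite_loopless_multigraph G \<longleftrightarrow>
     finite (verts G) \<and> finite (edges G) \<and>
     (\<forall>e\<in>edges G. ends G e \<subseteq> verts G \<and> card (ends G e) = 2)"

definition adjacent :: "('v, 'e) multigraph \<Rightarrow> 'v \<Rightarrow> 'v \<Rightarrow> bool" where
  "adjacent G u v \<longleftrightarrow> (\<exists>e\<in>edges G. ends G e = {u, v})"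

definition induced_edge_count :: "('v, 'e) multigraph \<Rightarrow> 'v set \<Rightarrow> nat" where
  "induced_edge_count G X = card {e \<in> edges G. ends G e \<subseteq> X}"

definition spanning_subgraph :: "('v, 'e) multigraph \<Rightarrow> ('v, 'e) multigraph \<Rightarrow> bool" where
  "spanning_subgraph F G \<longleftrightarrow>
     verts F = verts G \<and> edges F \<subseteq> edges G \<and> (\<forall>e\<in>edges F. ends F e = ends G e)"

definition two_intersecting_supermodular :: "'v set \<Rightarrow> ('v set \<Rightarrow> int) \<Rightarrow> bool" where
  "two_intersecting_supermodular V l \<longleftrightarrow>
     (\<forall>A B. A \<subseteq> V \<and> B \<subseteq> V \<and> card (A \<inter> B) \<ge> 2 \<longrightarrow>
        l (A \<inter> B) + l (A \<union> B) \<ge> l A + l B)"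

definition weakly_subadditive :: "'v set \<Rightarrow> ('v set \<Rightarrow> int) \<Rightarrow> bool" where
  "weakly_subadditive V l \<longleftrightarrow> (\<forall>A\<subseteq>V. (\<Sum>v\<in>A. l {v}) \<ge> l A)"

definition rigid :: "('v set \<Rightarrow> int) \<Rightarrow> ('v, 'e) multigraph \<Rightarrow> bool" where
  "rigid f H \<longleftrightarrow>
     (\<exists>F. spanning_subgraph F H \<and>
        (\<forall>X\<subseteq>verts H. int (induced_edge_count F X) \<le> (\<Sum>v\<in>X. f {v}) - f X) \<and>
        int (card (edges F)) = (\<Sum>v\<in>verts H. f {v}) - f (verts H))"

text \<open>
  The factors are indexed by \<open>{..<p}\<close> rather than collected in a set, because some of them may
  have no edges.
\<close>

definition decomposes_into_rigid ::
    "('v, 'e) multigraph \<Rightarrow> nat \<Rightarrow> ('v set \<Rightarrow> int) \<Rightarrow> bool" where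
  "decomposes_into_rigid G p f \<longleftrightarrow>
     (\<exists>H :: nat \<Rightarrow> ('v, 'e) multigraph.
        (\<forall>i<p. spanning_subgraph (H i) G \<and> rigid f (H i)) \<and>
        disjoint_family_on (\<lambda>i. edges (H i)) {..<p} \<and>
        (\<Union>i<p. edges (H i)) = edges G)"

end

theory Submission
  imports Defs
begin

text \<open>
  Put \<open>b X = (\<Sum>v\<in>X. l {v}) - l X\<close>. The edge sets \<open>F\<close> with \<open>e\<^sub>F(X) \<le> b X\<close> for all \<open>X\<close> are the
  independent sets of a matroid: tight vertex sets meeting in at least two vertices are closed
  under union, so the maximal tight sets of \<open>F\<close> partition \<open>F\<close> (single edges are tight
  because \<open>b {u, v} = 1\<close>), and the size of \<open>F\<close> is the sum of their \<open>b\<close>-values. Consequently an edge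
  set \<open>F\<close> with \<open>e\<^sub>F(X) \<le> p * b X\<close> for all \<open>X\<close> satisfies the condition of Edmonds' covering theorem
  and splits into \<open>p\<close> independent sets. If \<open>|F| = p * b V\<close>, each of them has exactly \<open>b V\<close>
  elements, and the edges outside \<open>F\<close> can be added to any of the parts.
\<close>

section \<open>Edmonds' covering theorem for matroids\<close>

locale finite_matroid =
  fixes E :: "'e set" and indep :: "'e set \<Rightarrow> bool"
  assumes finite_ground: "finite E"
    and indep_subset_ground: "indep I \<Longrightarrow> I \<subseteq> E"
    and indep_empty: "indep {}"
    and indep_mono: "indep I \<Longrightarrow> J \<subseteq> I \<Longrightarrow> indep J"
    and augment: "indep I \<Longrightarrow> indep J \<Longrightarrow> card I < card J \<Longrightarrow> \<exists>x\<in>J - I. indep (insert x I)"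
begin

section \<open>Span and extension of independent sets\<close>

lemma indep_finite: "indep I \<Longrightarrow> finite I"
  using finite_ground finite_subset indep_subset_ground by blast

text \<open>For independent \<open>I\<close> this is the matroid closure; for dependent
  \<open>I\<close> it is all of \<open>E\<close>.\<close>

definition spanned :: "'e set \<Rightarrow> 'e set" where
  "spanned I = {x \<in> E. x \<in> I \<or> \<not> indep (insert x I)}"

lemma subset_spanned: "indep I \<Longrightarrow> I \<subseteq> spanned I"
  using indep_subset_ground unfolding spanned_def by blast

text \<open>A larger \<open>J\<close> would augment \<open>I\<close> by an element outside
  \<open>spanned I\<close>.\<close>

lemma card_le_of_subset_spanned:
  assumes "indep I" "indep J" "J \<subseteq> spanned I"
  shows "card J \<le> card I"
  using augment[OF assms(1,2)] assms(3) unfolding spanned_def by fastforce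

text \<open>If \<open>x\<close> were spanned by \<open>I\<close> but not by \<open>J\<close>, then
  \<open>insert x J\<close> would be an independent subset of \<open>spanned I\<close> with more
  elements than \<open>I\<close>.\<close>

lemma spanned_mono_of_card_eq:
  assumes I: "indep I" and J: "indep J" and "card I = card J" "J \<subseteq> spanned I"
  shows "spanned I \<subseteq> spanned J"
proof
  fix x assume x: "x \<in> spanned I"
  show "x \<in> spanned J"
  proof (rule ccontr)
    assume "x \<notin> spanned J"
    then have "x \<notin> J" "indep (insert x J)"
      using x unfolding spanned_def by auto
    with card_le_of_subset_spanned[OF I this(2)] x assms(3,4) indep_finite[OF J]
    show False by simp
  qed
qed

lemma spanned_eq_of_card_eq:
  assumes "indep I" "indep J" "card I = card J" "J \<subseteq> spanned I"
  shows "spanned I = spanned J"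
proof -
  have "spanned I \<subseteq> spanned J" using spanned_mono_of_card_eq assms by blast
  \<comment> \<open>The roles can be swapped because \<open>I\<close> lies in
    \<open>spanned I\<close>, hence in \<open>spanned J\<close>.\<close>
  moreover from this have "spanned J \<subseteq> spanned I"
    using spanned_mono_of_card_eq[of J I] subset_spanned assms by auto
  ultimately show ?thesis by blast
qed

lemma extend_to_card:
  assumes "indep K" "indep I" "card K \<le> card I"
  shows "\<exists>L. indep L \<and> K \<subseteq> L \<and> L \<subseteq> K \<union> I \<and> card L = card I"
  using assms
proof (induction "card I - card K" arbitrary: K)
  case 0
  then show ?case by (intro exI[of _ K]) auto
next
  case (Suc n)
  have "card K < card I" using Suc.hyps(2) by simp
  then obtain x where x: "x \<in> I - K" "indep (insert x K)"
    using augment[of K I] Suc.prems by blast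
  have c: "card (insert x K) = Suc (card K)"
    using x indep_finite[OF Suc.prems(1)] by simp
  have "\<exists>L. indep L \<and> insert x K \<subseteq> L \<and> L \<subseteq> insert x K \<union> I \<and> card L = card I"
    using Suc.hyps(2) c by (intro Suc.hyps(1) x Suc.prems) auto
  with x show ?case by blast
qed

text \<open>The set of exchangeable \<open>y\<close>, together with \<open>e\<close>, is the fundamental circuit of \<open>e\<close>.\<close>

lemma exchangeable_dependent:
  assumes I: "indep I" and e: "e \<notin> I" "\<not> indep (insert e I)"
  shows "\<not> indep (insert e {y \<in> I. indep (insert e (I - {y}))})" (is "\<not> indep (insert e ?C)")
proof
  assume ind: "indep (insert e ?C)"
  have fin: "finite I" using I by (rule indep_finite)
  have "?C \<noteq> I"
  proof
    assume eq: "?C = I"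
    show False using ind e(2) unfolding eq by contradiction
  qed
  then have "card ?C < card I" using fin by (intro psubset_card_mono) auto
  then have "card (insert e ?C) \<le> card I" using fin e by simp
  then obtain L where L: "indep L" "insert e ?C \<subseteq> L" "L \<subseteq> insert e ?C \<union> I" "card L = card I"
    using extend_to_card[OF ind I] by blast
  \<comment> \<open>As \<open>insert e I\<close> is dependent, \<open>L\<close> misses some
    \<open>y\<close> in \<open>I\<close>. Cardinality then forces \<open>L\<close> to be
    \<open>I\<close> with \<open>y\<close> replaced by \<open>e\<close>, so \<open>y\<close> is
    exchangeable and should belong to \<open>L\<close>.\<close>
  have "\<not> I \<subseteq> L" using L e indep_mono[OF L(1)] by auto
  then obtain y where y: "y \<in> I" "y \<notin> L" by blast
  have "L \<subseteq> insert e (I - {y})" using L(3) y by auto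
  moreover have "card (insert e (I - {y})) = card I"
    using y fin e by (metis DiffD1 card_Suc_Diff1 card_insert_disjoint finite_Diff)
  ultimately have "L = insert e (I - {y})"
    using L(4) fin by (intro card_subset_eq) auto
  with L y show False by auto
qed

section \<open>Maximum packings and exchanges\<close>

definition packing :: "nat \<Rightarrow> (nat \<Rightarrow> 'e set) \<Rightarrow> bool" where
  "packing p F \<longleftrightarrow> (\<forall>i<p. indep (F i)) \<and> disjoint_family_on F {..<p}"

definition covered :: "nat \<Rightarrow> (nat \<Rightarrow> 'e set) \<Rightarrow> 'e set" where
  "covered p F = (\<Union>i<p. F i)"

definition max_packing :: "nat \<Rightarrow> (nat \<Rightarrow> 'e set) \<Rightarrow> bool" where
  "max_packing p F \<longleftrightarrow>
     packing p F \<and> (\<forall>F'. packing p F' \<longrightarrow> card (covered p F') \<le> card (covered p F))"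

text \<open>Such a swap keeps the number of covered elements and trades the uncovered
  \<open>e\<close> for \<open>y\<close>; iterating it reveals which elements can be left
  uncovered.\<close>

definition exchange :: "nat \<Rightarrow> (nat \<Rightarrow> 'e set) \<Rightarrow> (nat \<Rightarrow> 'e set) \<Rightarrow> bool" where
  "exchange p F F' \<longleftrightarrow> (\<exists>i<p. \<exists>e\<in>E - covered p F. \<exists>y\<in>F i.
     indep (insert e (F i - {y})) \<and> F' = F(i := insert e (F i - {y})))"

lemma covered_subset_ground: "packing p F \<Longrightarrow> covered p F \<subseteq> E"
  using indep_subset_ground unfolding packing_def covered_def by blast

lemma packing_update:
  assumes "packing p F" "i < p" "e \<notin> covered p F" "A \<subseteq> F i" "indep (insert e A)"
  shows "packing p (F(i := insert e A))"
proof -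
  have disj: "F j \<inter> F k = {}" if "j < p" "k < p" "j \<noteq> k" for j k
    using assms(1) that unfolding packing_def disjoint_family_on_def by blast
  have "insert e A \<inter> F j = {}" if "j < p" "j \<noteq> i" for j
    using disj[of i j] that assms(2-4) unfolding covered_def by blast
  then have "disjoint_family_on (F(i := insert e A)) {..<p}"
    using disj unfolding disjoint_family_on_def by (simp add: Int_commute)
  moreover have "indep ((F(i := insert e A)) j)" if "j < p" for j
    using assms(1,5) that unfolding packing_def by simp
  ultimately show ?thesis unfolding packing_def by blast
qed

text \<open>By disjointness no other member contains \<open>y\<close>, so dropping it from
  \<open>F i\<close> really uncovers it.\<close>

lemma covered_exchange:
  assumes "packing p F" "i < p" "e \<notin> covered p F" "y \<in> F i"
  shows "covered p (F(i := insert e (F i - {y}))) = insert e (covered p F - {y})"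
proof -
  have "y \<notin> F j" if "j < p" "j \<noteq> i" for j
    using assms that unfolding packing_def disjoint_family_on_def by blast
  moreover have "e \<noteq> y" using assms unfolding covered_def by auto
  ultimately show ?thesis
    using assms(2) unfolding covered_def by (auto split: if_splits)
qed

lemma max_packing_exchange:
  assumes F: "max_packing p F" and ex: "exchange p F F'"
  shows "max_packing p F'"
proof -
  obtain i e y where i: "i < p" and e: "e \<in> E" "e \<notin> covered p F" and y: "y \<in> F i"
    and ind: "indep (insert e (F i - {y}))" and F': "F' = F(i := insert e (F i - {y}))"
    using ex unfolding exchange_def by blast
  have pF: "packing p F" using F unfolding max_packing_def by blast
  have fin: "finite (covered p F)"
    using covered_subset_ground[OF pF] finite_ground finite_subset by blast
  have "y \<in> covered p F" using i y unfolding covered_def by blast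
  then have "card (covered p F') = card (covered p F)"
    unfolding F' covered_exchange[OF pF i e(2) y] using fin e
    by (metis DiffD1 card_Suc_Diff1 card_insert_disjoint finite_Diff)
  moreover have "packing p F'" unfolding F' using packing_update[OF pF i e(2) _ ind] by blast
  ultimately show ?thesis using F unfolding max_packing_def by simp
qed

lemma max_packing_insert_dependent:
  assumes F: "max_packing p F" and i: "i < p" and e: "e \<in> E" "e \<notin> covered p F"
  shows "\<not> indep (insert e (F i))"
proof
  assume ind: "indep (insert e (F i))"
  have pF: "packing p F" using F unfolding max_packing_def by blast
  have fin: "finite (covered p F)"
    using covered_subset_ground[OF pF] finite_ground finite_subset by blast
  have "covered p (F(i := insert e (F i))) = insert e (covered p F)"
    using i unfolding covered_def by (auto split: if_splits)
  then have "card (covered p (F(i := insert e (F i)))) > card (covered p F)"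
    using fin e by simp
  moreover have "packing p (F(i := insert e (F i)))"
    using packing_update[OF pF i e(2) _ ind] by blast
  ultimately show False using F unfolding max_packing_def by (meson leD)
qed

lemma max_packing_exists: "\<exists>F. max_packing p F"
proof -
  have "packing p (\<lambda>i. {})"
    using indep_empty unfolding packing_def disjoint_family_on_def by simp
  \<comment> \<open>The number of covered elements is bounded by \<open>card E\<close>, so a
    greatest value is attained.\<close>
  moreover have "\<forall>F. packing p F \<longrightarrow> card (covered p F) < Suc (card E)"
    by (intro allI impI le_imp_less_Suc card_mono finite_ground covered_subset_ground)
  ultimately show ?thesis
    unfolding max_packing_def by (rule ex_has_greatest_nat)
qed

text \<open>
  Starting from a maximum packing, let \<open>D\<close> be the set of elements left uncovered by some packing
  reachable through exchanges. Fundamental circuits of uncovered elements stay inside \<open>D\<close>, so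
  exchanges do not change the span of \<open>F i \<inter> D\<close>; hence every \<open>F i \<inter> D\<close> spans \<open>D\<close>, and an
  uncovered element would make \<open>D\<close> too large.
\<close>

theorem covering_by_independent_sets:
  assumes rank: "\<And>A. A \<subseteq> E \<Longrightarrow> \<exists>I\<subseteq>A. indep I \<and> card A \<le> p * card I"
  shows "\<exists>F. (\<forall>i<p. indep (F i)) \<and> disjoint_family_on F {..<p} \<and> (\<Union>i<p. F i) = E"
proof -
  obtain F0 where F0: "max_packing p F0" using max_packing_exists by blast
  define R where "R = {F. (exchange p)\<^sup>*\<^sup>* F0 F}"
  define D where "D = (\<Union>F\<in>R. E - covered p F)"
  have R_max: "max_packing p F" if "F \<in> R" for F
  proof -
    have "(exchange p)\<^sup>*\<^sup>* F0 F" using that unfolding R_def by simp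
    then show ?thesis by induction (auto intro: F0 max_packing_exchange)
  qed
  have R_ind: "indep (F i)" if "F \<in> R" "i < p" for F i
    using R_max[OF that(1)] that(2) unfolding max_packing_def packing_def by blast
  have R_step: "F' \<in> R" if "F \<in> R" "exchange p F F'" for F F'
    using that unfolding R_def by (auto intro: rtranclp.rtrancl_into_rtrancl)
  have D_E: "D \<subseteq> E" unfolding D_def by blast
  \<comment> \<open>Exchanging \<open>e\<close> for any \<open>y\<close> of its fundamental circuit
    in \<open>F i\<close> leaves \<open>y\<close> uncovered, so \<open>y\<close> is in
    \<open>D\<close>. Thus the dependence of \<open>e\<close> is already visible in
    \<open>F i \<inter> D\<close>.\<close>
  have uncovered_spanned: "e \<in> spanned (F i \<inter> D)"
    if F: "F \<in> R" and i: "i < p" and e: "e \<in> E" "e \<notin> covered p F" for F i e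
  proof -
    have pF: "packing p F" using R_max[OF F] unfolding max_packing_def by blast
    have eF: "e \<notin> F i" using e i unfolding covered_def by blast
    have "y \<in> D" if y: "y \<in> F i" "indep (insert e (F i - {y}))" for y
    proof -
      let ?F' = "F(i := insert e (F i - {y}))"
      have "?F' \<in> R" using F i e y by (intro R_step[OF F]) (auto simp: exchange_def)
      moreover have "y \<notin> covered p ?F'"
        unfolding covered_exchange[OF pF i e(2) y(1)] using eF y by auto
      moreover have "y \<in> E" using indep_subset_ground[OF R_ind[OF F i]] y by blast
      ultimately show ?thesis unfolding D_def by blast
    qed
    then have "insert e {y \<in> F i. indep (insert e (F i - {y}))} \<subseteq> insert e (F i \<inter> D)" by blast
    then have "\<not> indep (insert e (F i \<inter> D))"
      using exchangeable_dependent[OF R_ind[OF F i] eF max_packing_insert_dependent[OF R_max[OF F] i e]]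
        indep_mono by blast
    then show ?thesis using e unfolding spanned_def by blast
  qed
  \<comment> \<open>The entering \<open>e\<close> is uncovered before the exchange and the leaving
    \<open>y\<close> after it, so both lie in \<open>D\<close>. The new trace on \<open>D\<close>
    has the size of the old one and lies in its span.\<close>
  have span_step: "spanned (F' j \<inter> D) = spanned (F j \<inter> D)"
    if F: "F \<in> R" and ex: "exchange p F F'" and j: "j < p" for F F' j
  proof -
    obtain i e y where i: "i < p" and e: "e \<in> E" "e \<notin> covered p F" and y: "y \<in> F i"
      and ind: "indep (insert e (F i - {y}))" and F': "F' = F(i := insert e (F i - {y}))"
      using ex unfolding exchange_def by blast
    have pF: "packing p F" using R_max[OF F] unfolding max_packing_def by blast
    have F'R: "F' \<in> R" using R_step[OF F ex] .
    show ?thesis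
    proof (cases "j = i")
      case False
      then show ?thesis unfolding F' by simp
    next
      case True
      have eF: "e \<notin> F i" using e i unfolding covered_def by blast
      have yE: "y \<in> E" using indep_subset_ground[OF R_ind[OF F i]] y by blast
      have "y \<notin> covered p F'"
        unfolding F' covered_exchange[OF pF i e(2) y] using eF y by auto
      then have yD: "y \<in> D" using F'R yE unfolding D_def by blast
      have eD: "e \<in> D" using F e unfolding D_def by blast
      have eq: "F' i \<inter> D = insert e (F i \<inter> D - {y})" unfolding F' using eD by auto
      have I: "indep (F i \<inter> D)" "indep (F' i \<inter> D)"
        using R_ind[OF F i] R_ind[OF F'R i] indep_mono by blast+
      have "card (F i \<inter> D) = card (F' i \<inter> D)"
        unfolding eq using indep_finite[OF I(1)] y yD eF
        by (metis DiffD1 IntI Int_iff card_Suc_Diff1 card_insert_disjoint finite_Diff)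
      moreover have "F' i \<inter> D \<subseteq> spanned (F i \<inter> D)"
        unfolding eq using uncovered_spanned[OF F i e] subset_spanned[OF I(1)] by blast
      ultimately show ?thesis using spanned_eq_of_card_eq[OF I] True by simp
    qed
  qed
  have span_const: "spanned (F i \<inter> D) = spanned (F0 i \<inter> D)" if "F \<in> R" "i < p" for F i
  proof -
    have "(exchange p)\<^sup>*\<^sup>* F0 F" using that unfolding R_def by simp
    then show ?thesis
    proof induction
      case (step F1 F2)
      then show ?case using span_step[of F1 F2 i] that(2) unfolding R_def by simp
    qed simp
  qed
  have F0R: "F0 \<in> R" unfolding R_def by simp
  \<comment> \<open>Each \<open>d\<close> is spanned by the traces of a reachable packing that
    misses it; constancy of the spans carries this back to \<open>F0\<close>.\<close>
  have D_spanned: "D \<subseteq> spanned (F0 i \<inter> D)" if i: "i < p" for i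
  proof
    fix d assume "d \<in> D"
    then obtain F where F: "F \<in> R" "d \<in> E" "d \<notin> covered p F" unfolding D_def by blast
    then show "d \<in> spanned (F0 i \<inter> D)"
      using uncovered_spanned[OF F(1) i F(2,3)] span_const[OF F(1) i] by blast
  qed
  obtain I where I: "I \<subseteq> D" "indep I" "card D \<le> p * card I" using rank[OF D_E] by blast
  have pF0: "packing p F0" using F0 unfolding max_packing_def by blast
  have finD: "finite D" using D_E finite_ground finite_subset by blast
  \<comment> \<open>Each of the \<open>p\<close> disjoint traces has at least \<open>card I\<close>
    elements, so together they have at least \<open>card D\<close> and fill \<open>D\<close>. Since
    every element uncovered by \<open>F0\<close> lies in \<open>D\<close>, none exists.\<close>
  have "card I \<le> card (F0 i \<inter> D)" if i: "i < p" for i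
  proof -
    have "indep (F0 i \<inter> D)" using R_ind[OF F0R i] indep_mono by blast
    then show ?thesis using card_le_of_subset_spanned I D_spanned[OF i] by blast
  qed
  then have "p * card I \<le> (\<Sum>i<p. card (F0 i \<inter> D))"
    using sum_bounded_below[of "{..<p}" "card I" "\<lambda>i. card (F0 i \<inter> D)"] by simp
  also have "\<dots> = card (\<Union>i<p. F0 i \<inter> D)"
    using pF0 finD unfolding packing_def disjoint_family_on_def
    by (intro card_UN_disjoint[symmetric]) blast+
  also have "(\<Union>i<p. F0 i \<inter> D) = covered p F0 \<inter> D" unfolding covered_def by blast
  finally have "card D \<le> card (covered p F0 \<inter> D)" using I by simp
  then have "covered p F0 \<inter> D = D" using finD by (intro card_seteq) auto
  moreover have "E - covered p F0 \<subseteq> D" using F0R unfolding D_def by blast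
  ultimately have "covered p F0 = E" using covered_subset_ground[OF pF0] by blast
  then show ?thesis using pF0 unfolding packing_def covered_def by blast
qed

end

section \<open>The matroid of sparse edge sets\<close>

text \<open>Here \<open>b\<close> stands for the sum of \<open>l\<close> over singletons minus
  \<open>l\<close>: nonnegativity is weak subadditivity, value one on ends is the condition on
  adjacent vertices, and submodularity comes from the supermodularity of \<open>l\<close>.\<close>

locale sparsity_bound =
  fixes V :: "'v set" and E :: "'e set" and ends :: "'e \<Rightarrow> 'v set" and b :: "'v set \<Rightarrow> int"
  assumes finite_V: "finite V" and finite_E: "finite E"
    and ends_V: "e \<in> E \<Longrightarrow> ends e \<subseteq> V"
    and card_ends: "e \<in> E \<Longrightarrow> card (ends e) = 2"
    and b_nonneg: "X \<subseteq> V \<Longrightarrow> b X \<ge> 0"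
    and b_ends: "e \<in> E \<Longrightarrow> b (ends e) = 1"
    and b_submodular: "X \<subseteq> V \<Longrightarrow> Y \<subseteq> V \<Longrightarrow> card (X \<inter> Y) \<ge> 2 \<Longrightarrow> b (X \<inter> Y) + b (X \<union> Y) \<le> b X + b Y"
begin

section \<open>Uncrossing tight sets\<close>

definition induced :: "'e set \<Rightarrow> 'v set \<Rightarrow> 'e set" where
  "induced F X = {e \<in> F. ends e \<subseteq> X}"

definition sparse :: "'e set \<Rightarrow> bool" where
  "sparse F \<longleftrightarrow> F \<subseteq> E \<and> (\<forall>X\<subseteq>V. int (card (induced F X)) \<le> b X)"

definition tight :: "'e set \<Rightarrow> 'v set \<Rightarrow> bool" where
  "tight F X \<longleftrightarrow> X \<subseteq> V \<and> int (card (induced F X)) = b X"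

lemma finite_induced: "F \<subseteq> E \<Longrightarrow> finite (induced F X)"
  using finite_E finite_subset unfolding induced_def by (metis (no_types, lifting) mem_Collect_eq subsetI)

text \<open>An edge counted for both \<open>X\<close> and \<open>Y\<close> has its ends in
  \<open>X \<inter> Y\<close>, and every edge counted at all has its ends in
  \<open>X \<union> Y\<close>.\<close>

lemma card_induced_supermodular:
  assumes "F \<subseteq> E"
  shows "card (induced F X) + card (induced F Y) \<le> card (induced F (X \<inter> Y)) + card (induced F (X \<union> Y))"
proof -
  have "card (induced F X) + card (induced F Y)
      = card (induced F X \<union> induced F Y) + card (induced F X \<inter> induced F Y)"
    using finite_induced[OF assms] by (intro card_Un_Int)
  moreover have "induced F X \<inter> induced F Y = induced F (X \<inter> Y)" unfolding induced_def by blast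
  moreover have "card (induced F X \<union> induced F Y) \<le> card (induced F (X \<union> Y))"
    using finite_induced[OF assms] by (intro card_mono) (auto simp: induced_def)
  ultimately show ?thesis by simp
qed

text \<open>Supermodularity of the edge count and submodularity of \<open>b\<close> squeeze the
  counts on intersection and union between equal sums, so both sparsity bounds hold with
  equality.\<close>

lemma tight_Un:
  assumes F: "sparse F" and X: "tight F X" and Y: "tight F Y" and "card (X \<inter> Y) \<ge> 2"
  shows "tight F (X \<union> Y)"
proof -
  have V: "X \<subseteq> V" "Y \<subseteq> V" using X Y unfolding tight_def by auto
  have "int (card (induced F (X \<inter> Y))) \<le> b (X \<inter> Y)" "int (card (induced F (X \<union> Y))) \<le> b (X \<union> Y)"
    using F V unfolding sparse_def by (auto simp: le_infI1)
  moreover have "card (induced F X) + card (induced F Y)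
      \<le> card (induced F (X \<inter> Y)) + card (induced F (X \<union> Y))"
    using F card_induced_supermodular unfolding sparse_def by blast
  ultimately show ?thesis
    using b_submodular[OF V assms(4)] X Y unfolding tight_def by auto
qed

text \<open>The edge \<open>e\<close> itself already uses up the bound
  \<open>b (ends e) = 1\<close>.\<close>

lemma tight_ends:
  assumes F: "sparse F" and e: "e \<in> F"
  shows "tight F (ends e)"
proof -
  have eE: "e \<in> E" and FE: "F \<subseteq> E" using F e unfolding sparse_def by auto
  have "e \<in> induced F (ends e)" using e unfolding induced_def by blast
  then have "card (induced F (ends e)) > 0" using finite_induced[OF FE] card_gt_0_iff by blast
  moreover have "int (card (induced F (ends e))) \<le> 1"
    using F ends_V[OF eE] b_ends[OF eE] unfolding sparse_def by metis
  ultimately show ?thesis using ends_V[OF eE] b_ends[OF eE] unfolding tight_def by simp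
qed

text \<open>A set violated after adding \<open>e\<close> must contain its ends; as the count grows
  by at most one, the set was tight before.\<close>

lemma blocked_by_tight:
  assumes F: "sparse F" and e: "e \<in> E" and blocked: "e \<in> F \<or> \<not> sparse (insert e F)"
  shows "\<exists>X. tight F X \<and> ends e \<subseteq> X"
proof (cases "e \<in> F")
  case True
  then show ?thesis using tight_ends[OF F] by blast
next
  case False
  have FE: "F \<subseteq> E" using F unfolding sparse_def by blast
  obtain X where X: "X \<subseteq> V" "\<not> int (card (induced (insert e F) X)) \<le> b X"
    using False blocked e FE unfolding sparse_def by blast
  have le: "int (card (induced F X)) \<le> b X" using F X unfolding sparse_def by blast
  have eX: "ends e \<subseteq> X"
  proof (rule ccontr)
    assume "\<not> ends e \<subseteq> X"
    then have "induced (insert e F) X = induced F X" unfolding induced_def by auto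
    then show False using X le by simp
  qed
  then have "induced (insert e F) X = insert e (induced F X)" unfolding induced_def by auto
  moreover have "card (insert e (induced F X)) \<le> Suc (card (induced F X))"
    by (rule card_insert_le_m1) auto
  ultimately have "tight F X" using X le unfolding tight_def by simp
  with eX show ?thesis by blast
qed

text \<open>Charge every element of \<open>S\<close> to a maximal tight set of \<open>F\<close> containing its ends.\<close>

lemma card_le_of_blocked:
  assumes F: "sparse F" and S: "S \<subseteq> E"
    and blocked: "\<And>e. e \<in> S \<Longrightarrow> e \<in> F \<or> \<not> sparse (insert e F)"
    and bound: "\<And>X. X \<subseteq> V \<Longrightarrow> int (card (induced S X)) \<le> int k * b X"
  shows "card S \<le> k * card F"
proof -
  define M where "M = {X. tight F X \<and> (\<forall>Y. tight F Y \<longrightarrow> X \<subseteq> Y \<longrightarrow> X = Y)}"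
  have MV: "M \<subseteq> Pow V" unfolding M_def tight_def by blast
  have finM: "finite M" using MV finite_V by (meson finite_Pow_iff finite_subset)
  have FE: "F \<subseteq> E" using F unfolding sparse_def by blast
  have in_M: "\<exists>Y\<in>M. X \<subseteq> Y" if X: "tight F X" for X
  proof -
    have fin: "finite {Y. tight F Y}"
      by (rule finite_subset[of _ "Pow V"]) (auto simp: tight_def finite_V)
    obtain Y where "Y \<in> {Y. tight F Y}" "X \<subseteq> Y" "\<forall>Z\<in>{Y. tight F Y}. Y \<subseteq> Z \<longrightarrow> Y = Z"
      using finite_has_maximal2[OF fin, of X] X by auto
    then have "Y \<in> M" unfolding M_def by simp
    with \<open>X \<subseteq> Y\<close> show ?thesis by blast
  qed
  \<comment> \<open>A common edge gives two common vertices, so the union would be tight, against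
    maximality.\<close>
  have M_disj: "induced F X \<inter> induced F Y = {}" if "X \<in> M" "Y \<in> M" "X \<noteq> Y" for X Y
  proof (rule ccontr)
    assume "induced F X \<inter> induced F Y \<noteq> {}"
    then obtain e where e: "e \<in> F" "ends e \<subseteq> X \<inter> Y" unfolding induced_def by auto
    have "finite (X \<inter> Y)" using that MV finite_V by (meson PowD finite_Int finite_subset subsetD)
    then have "card (X \<inter> Y) \<ge> 2" using card_mono[OF _ e(2)] card_ends e FE by fastforce
    moreover have "tight F X" "tight F Y" using that unfolding M_def by simp_all
    ultimately have "tight F (X \<union> Y)" using tight_Un[OF F] by simp
    then have "X = X \<union> Y" "Y = X \<union> Y" using that(1,2) unfolding M_def by simp_all
    with that(3) show False by simp
  qed
  have "S \<subseteq> (\<Union>X\<in>M. induced S X)"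
  proof
    fix e assume e: "e \<in> S"
    then obtain X where "tight F X" "ends e \<subseteq> X" using blocked_by_tight[OF F] blocked S by blast
    with in_M obtain Y where "Y \<in> M" "ends e \<subseteq> Y" by blast
    then show "e \<in> (\<Union>X\<in>M. induced S X)" using e unfolding induced_def by blast
  qed
  then have "card S \<le> card (\<Union>X\<in>M. induced S X)"
    using finM finite_induced[OF S] by (intro card_mono) auto
  also have "\<dots> \<le> (\<Sum>X\<in>M. card (induced S X))" using finM by (rule card_UN_le)
  finally have "int (card S) \<le> (\<Sum>X\<in>M. int (card (induced S X)))" by (simp flip: of_nat_sum)
  \<comment> \<open>Tightness replaces \<open>b X\<close> by the number of edges of \<open>F\<close>
    inside \<open>X\<close>.\<close>
  also have "\<dots> \<le> (\<Sum>X\<in>M. int k * int (card (induced F X)))"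
    using bound unfolding M_def tight_def by (intro sum_mono) auto
  also have "\<dots> = int (k * (\<Sum>X\<in>M. card (induced F X)))" by (simp add: sum_distrib_left)
  finally have "card S \<le> k * (\<Sum>X\<in>M. card (induced F X))" by (simp only: of_nat_le_iff)
  also have "(\<Sum>X\<in>M. card (induced F X)) = card (\<Union>X\<in>M. induced F X)"
    using finM finite_induced[OF FE] M_disj by (intro card_UN_disjoint[symmetric]) auto
  also have "k * \<dots> \<le> k * card F"
    using finite_subset[OF FE finite_E] by (intro mult_le_mono2 card_mono) (auto simp: induced_def)
  finally show ?thesis .
qed

section \<open>Sparse sets as the independent sets of a matroid\<close>

lemma sparse_mono:
  assumes "sparse F" "F' \<subseteq> F"
  shows "sparse F'"
proof -
  have "card (induced F' X) \<le> card (induced F X)" for X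
    using assms finite_induced[of F X] unfolding sparse_def
    by (intro card_mono) (auto simp: induced_def)
  then show ?thesis using assms unfolding sparse_def by (meson of_nat_mono order_trans)
qed

sublocale sparse: finite_matroid E sparse
proof
  show "finite E" by (rule finite_E)
  show "I \<subseteq> E" if "sparse I" for I using that unfolding sparse_def by blast
  show "sparse {}" using b_nonneg unfolding sparse_def induced_def by simp
  show "sparse J" if "sparse I" "J \<subseteq> I" for I J using that by (rule sparse_mono)
  \<comment> \<open>If no element of \<open>J\<close> could be added, all of \<open>J\<close> would
    be blocked by \<open>I\<close>; charging with factor 1, justified by the sparsity of
    \<open>J\<close>, gives \<open>card J \<le> card I\<close>.\<close>
  show "\<exists>x\<in>J - I. sparse (insert x I)" if "sparse I" "sparse J" "card I < card J" for I J
    using card_le_of_blocked[of I J 1] that unfolding sparse_def[of J] by fastforce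
qed

theorem partition_into_sparse:
  assumes bound: "\<And>X. X \<subseteq> V \<Longrightarrow> int (card (induced E X)) \<le> int p * b X"
  shows "\<exists>F. (\<forall>i<p. sparse (F i)) \<and> disjoint_family_on F {..<p} \<and> (\<Union>i<p. F i) = E"
proof (rule sparse.covering_by_independent_sets)
  fix A assume A: "A \<subseteq> E"
  then have finA: "finite A" using finite_E finite_subset by blast
  then have fin: "finite {I. I \<subseteq> A \<and> sparse I}" by simp
  \<comment> \<open>An inclusion-maximal sparse \<open>I\<close> in \<open>A\<close> blocks every
    element of \<open>A\<close>, so charging with factor \<open>p\<close> yields the rank
    condition.\<close>
  obtain I where I: "I \<subseteq> A" "sparse I" "\<forall>J. J \<subseteq> A \<and> sparse J \<longrightarrow> I \<subseteq> J \<longrightarrow> I = J"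
    using finite_has_maximal2[OF fin, of "{}"] sparse.indep_empty by auto
  have "card A \<le> p * card I"
  proof (rule card_le_of_blocked[OF I(2) A])
    show "e \<in> I \<or> \<not> sparse (insert e I)" if "e \<in> A" for e
      using I that by (metis insertI1 insert_subset subset_insertI)
    show "int (card (induced A X)) \<le> int p * b X" if "X \<subseteq> V" for X
    proof -
      have "card (induced A X) \<le> card (induced E X)"
        using A finite_induced[of E X] by (intro card_mono) (auto simp: induced_def)
      then show ?thesis using bound[OF that] by linarith
    qed
  qed
  then show "\<exists>I\<subseteq>A. sparse I \<and> card A \<le> p * card I" using I by blast
qed

lemma sparse_card_le: "sparse F \<Longrightarrow> int (card F) \<le> b V"
proof -
  assume F: "sparse F"
  then have "induced F V = F" using ends_V unfolding sparse_def induced_def by blast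
  with F show ?thesis unfolding sparse_def by (metis order_refl)
qed

end

section \<open>Rigid decompositions\<close>

lemma sum_multiple_minus:
  "(\<Sum>v\<in>X. int p * l {v}) - int p * l X = int p * ((\<Sum>v\<in>X. l {v}) - l X)"
  by (simp add: sum_distrib_left right_diff_distrib)

text \<open>The vertex sum is modular, so subtracting \<open>l\<close> reverses the
  inequality.\<close>

lemma submodular_of_two_intersecting_supermodular:
  assumes "two_intersecting_supermodular V l" "finite V" "A \<subseteq> V" "B \<subseteq> V" "card (A \<inter> B) \<ge> 2"
  shows "((\<Sum>v\<in>A \<inter> B. l {v}) - l (A \<inter> B)) + ((\<Sum>v\<in>A \<union> B. l {v}) - l (A \<union> B))
    \<le> ((\<Sum>v\<in>A. l {v}) - l A) + ((\<Sum>v\<in>B. l {v}) - l B)"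
proof -
  have "(\<Sum>v\<in>A \<union> B. l {v}) + (\<Sum>v\<in>A \<inter> B. l {v}) = (\<Sum>v\<in>A. l {v}) + (\<Sum>v\<in>B. l {v})"
    using assms finite_subset by (intro sum.union_inter) blast+
  moreover have "l (A \<inter> B) + l (A \<union> B) \<ge> l A + l B"
    using assms unfolding two_intersecting_supermodular_def by blast
  ultimately show ?thesis by linarith
qed

lemma rigid_of_decomposition:
  fixes G :: "('v, 'e) multigraph"
  assumes G: "finite_loopless_multigraph G" and dec: "decomposes_into_rigid G p l"
  shows "rigid (\<lambda>X. int p * l X) G"
proof -
  obtain H :: "nat \<Rightarrow> ('v, 'e) multigraph" where
    H: "\<And>i. i < p \<Longrightarrow> spanning_subgraph (H i) G" "\<And>i. i < p \<Longrightarrow> rigid l (H i)"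
    and disj: "disjoint_family_on (\<lambda>i. edges (H i)) {..<p}"
    using dec unfolding decomposes_into_rigid_def by blast
  let ?b = "\<lambda>X. (\<Sum>v\<in>X. l {v}) - l X"
  have "\<exists>F. spanning_subgraph F (H i) \<and>
      (\<forall>X\<subseteq>verts G. int (induced_edge_count F X) \<le> ?b X) \<and> int (card (edges F)) = ?b (verts G)"
    if "i < p" for i
    using H[OF that] unfolding rigid_def spanning_subgraph_def by auto
  then obtain F where F: "\<And>i. i < p \<Longrightarrow> spanning_subgraph (F i) (H i)"
      "\<And>i X. i < p \<Longrightarrow> X \<subseteq> verts G \<Longrightarrow> int (induced_edge_count (F i) X) \<le> ?b X"
      "\<And>i. i < p \<Longrightarrow> int (card (edges (F i))) = ?b (verts G)"
    by metis
  have FH: "edges (F i) \<subseteq> edges (H i)" "edges (F i) \<subseteq> edges G"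
    "\<And>e. e \<in> edges (F i) \<Longrightarrow> ends (F i) e = ends G e" if "i < p" for i
    using F(1)[OF that] H(1)[OF that] unfolding spanning_subgraph_def by auto
  have fin: "finite (edges (F i))" if "i < p" for i
    using G FH(2)[OF that] finite_subset unfolding finite_loopless_multigraph_def by blast
  \<comment> \<open>The witness for \<open>G\<close> is the union of the witnesses of the factors;
    by disjointness their edge counts add up.\<close>
  define K where "K = G\<lparr>edges := (\<Union>i<p. edges (F i))\<rparr>"
  have Fdisj: "edges (F i) \<inter> edges (F j) = {}" if "i < p" "j < p" "i \<noteq> j" for i j
    using disj FH(1)[OF that(1)] FH(1)[OF that(2)] that unfolding disjoint_family_on_def by blast
  have count: "induced_edge_count K X = (\<Sum>i<p. induced_edge_count (F i) X)" for X
  proof -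
    have "{e \<in> edges K. ends K e \<subseteq> X} = (\<Union>i<p. {e \<in> edges (F i). ends G e \<subseteq> X})"
      unfolding K_def by auto
    also have "card \<dots> = (\<Sum>i<p. card {e \<in> edges (F i). ends G e \<subseteq> X})"
      using fin Fdisj by (intro card_UN_disjoint) auto
    also have "\<dots> = (\<Sum>i<p. induced_edge_count (F i) X)"
    proof (intro sum.cong refl)
      fix i assume "i \<in> {..<p}"
      then have "{e \<in> edges (F i). ends G e \<subseteq> X} = {e \<in> edges (F i). ends (F i) e \<subseteq> X}"
        using FH(3) by auto
      then show "card {e \<in> edges (F i). ends G e \<subseteq> X} = induced_edge_count (F i) X"
        unfolding induced_edge_count_def by simp
    qed
    finally show ?thesis unfolding induced_edge_count_def .
  qed
  have "spanning_subgraph K G" using FH(2) unfolding K_def spanning_subgraph_def by auto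
  moreover have "int (induced_edge_count K X) \<le> int p * ?b X" if "X \<subseteq> verts G" for X
  proof -
    have "(\<Sum>i<p. int (induced_edge_count (F i) X)) \<le> (\<Sum>i<p. ?b X)"
      using F(2) that by (intro sum_mono) auto
    then show ?thesis unfolding count by simp
  qed
  moreover have "int (card (edges K)) = int p * ?b (verts G)"
  proof -
    have "card (edges K) = (\<Sum>i<p. card (edges (F i)))"
      using fin Fdisj unfolding K_def by (simp add: card_UN_disjoint)
    then have "int (card (edges K)) = (\<Sum>i<p. int (card (edges (F i))))" by simp
    also have "\<dots> = (\<Sum>i<p. ?b (verts G))" using F(3) by (intro sum.cong) auto
    finally show ?thesis by simp
  qed
  ultimately show ?thesis unfolding rigid_def sum_multiple_minus by blast
qed

theorem theorem4p2:
  fixes G :: "('v, 'e) multigraph"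
    and p :: nat
    and l :: "'v set \<Rightarrow> int"
  assumes "finite_loopless_multigraph G"
    and "p > 0"
    and "l {} = 0"
    and "two_intersecting_supermodular (verts G) l"
    and "weakly_subadditive (verts G) l"
    and "\<And>u v. adjacent G u v \<Longrightarrow> l {u} + l {v} = l {u, v} + 1"
  shows "rigid (\<lambda>X. int p * l X) G \<longleftrightarrow> decomposes_into_rigid G p l"
proof
  assume "decomposes_into_rigid G p l"
  then show "rigid (\<lambda>X. int p * l X) G" using rigid_of_decomposition assms(1) by blast
next
  assume rigid: "rigid (\<lambda>X. int p * l X) G"
  define b where "b X = (\<Sum>v\<in>X. l {v}) - l X" for X
  obtain F where F: "spanning_subgraph F G"
      "\<And>X. X \<subseteq> verts G \<Longrightarrow> int (induced_edge_count F X) \<le> int p * b X"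
      "int (card (edges F)) = int p * b (verts G)"
    using rigid unfolding rigid_def sum_multiple_minus b_def by blast
  have FG: "edges F \<subseteq> edges G" "\<And>e. e \<in> edges F \<Longrightarrow> ends F e = ends G e"
    using F(1) unfolding spanning_subgraph_def by auto
  have G: "finite (verts G)" "finite (edges G)"
    "\<And>e. e \<in> edges G \<Longrightarrow> ends G e \<subseteq> verts G" "\<And>e. e \<in> edges G \<Longrightarrow> card (ends G e) = 2"
    using assms(1) unfolding finite_loopless_multigraph_def by auto
  have b_ends: "b (ends G e) = 1" if e: "e \<in> edges G" for e
  proof -
    obtain u v where uv: "ends G e = {u, v}" "u \<noteq> v" using G(4)[OF e] card_2_iff by metis
    then have "l {u} + l {v} = l {u, v} + 1" using e by (intro assms(6)) (auto simp: adjacent_def)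
    with uv show ?thesis unfolding b_def by simp
  qed
  \<comment> \<open>The ground set is \<open>edges F\<close>, since only the witness
    \<open>F\<close>, and not all of \<open>G\<close>, is known to obey the bound
    \<open>p * b X\<close>.\<close>
  interpret sparsity_bound "verts G" "edges F" "ends G" b
  proof
    show "b X \<ge> 0" if "X \<subseteq> verts G" for X
      using assms(5) that unfolding weakly_subadditive_def b_def by simp
    show "b (X \<inter> Y) + b (X \<union> Y) \<le> b X + b Y"
      if "X \<subseteq> verts G" "Y \<subseteq> verts G" "card (X \<inter> Y) \<ge> 2" for X Y
      using submodular_of_two_intersecting_supermodular[OF assms(4) G(1) that] unfolding b_def .
  qed (use G FG b_ends finite_subset in blast)+
  have "int (card (induced (edges F) X)) \<le> int p * b X" if "X \<subseteq> verts G" for X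
  proof -
    have "induced (edges F) X = {e \<in> edges F. ends F e \<subseteq> X}" using FG(2) unfolding induced_def by auto
    then show ?thesis using F(2)[OF that] unfolding induced_edge_count_def by simp
  qed
  then obtain P where P: "\<And>i. i < p \<Longrightarrow> sparse (P i)" "disjoint_family_on P {..<p}"
      "(\<Union>i<p. P i) = edges F"
    using partition_into_sparse[of p] by blast
  have PF: "P i \<subseteq> edges F" if "i < p" for i using P(3) that by blast
  \<comment> \<open>Each of the \<open>p\<close> parts has at most \<open>b (verts G)\<close> edges
    and their total is \<open>p * b (verts G)\<close>, so no part can fall short.\<close>
  have P_card: "int (card (P i)) = b (verts G)" if i: "i < p" for i
  proof (rule ccontr)
    assume "int (card (P i)) \<noteq> b (verts G)"
    then have "int (card (P i)) < b (verts G)" using sparse_card_le[OF P(1)[OF i]] by simp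
    then have "(\<Sum>i<p. int (card (P i))) < (\<Sum>i<p. b (verts G))"
      using sparse_card_le P(1) i by (intro sum_strict_mono_ex1) auto
    moreover have "card (edges F) = (\<Sum>i<p. card (P i))"
      unfolding P(3)[symmetric] using P(2) sparse.indep_finite[OF P(1)]
      unfolding disjoint_family_on_def by (intro card_UN_disjoint) auto
    ultimately show False using F(3) by simp
  qed
  \<comment> \<open>Edges of \<open>G\<close> outside \<open>F\<close> go to part 0, which exists
    because \<open>p > 0\<close>. Rigidity survives, since \<open>P i\<close> remains a witness
    after edges are added.\<close>
  define H where "H i = G\<lparr>edges := P i \<union> (if i = 0 then edges G - edges F else {})\<rparr>" for i :: nat
  have "spanning_subgraph (H i) G" if "i < p" for i
    using PF[OF that] FG(1) unfolding H_def spanning_subgraph_def by auto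
  moreover have "rigid l (H i)" if i: "i < p" for i
  proof -
    have "spanning_subgraph (G\<lparr>edges := P i\<rparr>) (H i)" unfolding H_def spanning_subgraph_def by simp
    moreover have "int (induced_edge_count (G\<lparr>edges := P i\<rparr>) X) \<le> b X" if "X \<subseteq> verts G" for X
      using P(1)[OF i] that unfolding sparse_def induced_def induced_edge_count_def by simp
    moreover have "verts (H i) = verts G" unfolding H_def by simp
    ultimately show ?thesis
      unfolding rigid_def using P_card[OF i] unfolding b_def
      by (intro exI[of _ "G\<lparr>edges := P i\<rparr>"]) simp
  qed
  moreover have "disjoint_family_on (\<lambda>i. edges (H i)) {..<p}"
    unfolding disjoint_family_on_def
  proof (intro ballI impI)
    fix i j assume ij: "i \<in> {..<p}" "j \<in> {..<p}" "i \<noteq> j"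
    then have "P i \<inter> P j = {}" using P(2) unfolding disjoint_family_on_def by blast
    with ij PF[of i] PF[of j] show "edges (H i) \<inter> edges (H j) = {}" unfolding H_def by auto
  qed
  moreover have "(\<Union>i<p. edges (H i)) = edges G"
  proof -
    have "(\<Union>i<p. edges (H i)) = (\<Union>i<p. P i) \<union> (edges G - edges F)"
      unfolding H_def using assms(2) by (auto split: if_splits)
    also have "\<dots> = edges G" unfolding P(3) using FG(1) by (rule Diff_partition)
    finally show ?thesis .
  qed
  ultimately show "decomposes_into_rigid G p l" unfolding decomposes_into_rigid_def by blast
qed

end
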